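(* Let $\mathcal{S}$ and $\tilde{\mathcal{S}}$ be two conformal smooth surfaces in $\mathbb{E}^3$ with dilation function $\zeta$, let $\beta(s)=\Psi(u(s),v(s))$ be a normal curve on $\mathcal{S}$, and let $\tilde\beta$ be its conformal image on $\tilde{\mathcal{S}}$, with the representations given in the context. Let $\mathbf T=a\Psi_u+b\Psi_v$ and $\tilde{\mathbf T}=a\tilde\Psi_u+b\tilde\Psi_v$. Then for the tangential component, $$\tilde\beta\cdot\tilde{\mathbf T}-\zeta^2(\beta\cdot\mathbf T)=(ag_1+bg_2)+\frac{\eta}{\kappa}\big(\tilde\kappa_n-\zeta^2\kappa_n\big)(av'+bu'),$$ where $$g_1=\frac{\nu}{\kappa}\Big[u'^2\zeta\zeta_u\mathcal E+2u'v'\zeta\zeta_v\mathcal E+v'^2(2\zeta\zeta_v\mathcal F-\zeta\zeta_u\mathcal G)\Big],$$ $$g_2=\frac{\nu}{\kappa}\Big[u'^2(2\zeta\zeta_u\mathcal F-\zeta\zeta_v\mathcal E)+2u'v'\zeta\zeta_u\mathcal G+v'^2\zeta\zeta_v\mathcal G\Big].$$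
   Context: $\Psi(u,v)$ is a patch of $\mathcal{S}$ and $\tilde\Psi=\mathcal{J}\circ\Psi$ the corresponding patch of $\tilde{\mathcal{S}}$ under the conformal map $\mathcal{J}:\mathcal{S}\to\tilde{\mathcal{S}}$; $a,b$ are the coefficients of the tangent vector $\mathbf T$. Conformal with dilation function $\zeta(u,v)$ means that the first fundamental form coefficients satisfy $\tilde{\mathcal E}=\zeta^2\mathcal E$, $\tilde{\mathcal F}=\zeta^2\mathcal F$, $\tilde{\mathcal G}=\zeta^2\mathcal G$. Quantities with tilde are those of $\tilde{\mathcal{S}}$, built from $\tilde\Psi$. Subscripts $u,v$ are partial derivatives, primes are $d/ds$, and functions of $(u,v)$ are evaluated at $(u(s),v(s))$. Surface normals are $\mathbf N=\Psi_u\times\Psi_v$ and $\tilde{\mathbf N}=\tilde\Psi_u\times\tilde\Psi_v$. With $\mathcal L=\Psi_{uu}\cdot\mathbf N$, $\mathcal M=\Psi_{uv}\cdot\mathbf N$, $\mathcal N=\Psi_{vv}\cdot\mathbf N$, the normal curvature is $\kappa_n=u'^2\mathcal L+2u'v'\mathcal M+v'^2\mathcal N$, and likewise $\tilde\kappa_n=u'^2\tilde{\mathcal L}+2u'v'\tilde{\mathcal M}+v'^2\tilde{\mathcal N}$. $\beta$ is parameterized by arc length, with curvature $\kappa$ and Serret-Frenet frame $\{\vec{\mathfrak t},\vec{\mathfrak n},\vec{\mathfrak b}\}$; it is a normal curve, i.e. its position vector is orthogonal to its tangent, $\beta=\nu\vec{\mathfrak n}+\eta\vec{\mathfrak b}$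 with smooth $\nu,\eta$. Equivalently $$\beta=\frac{\nu}{\kappa}X+\frac{\eta}{\kappa}\,(u'\Psi_u+v'\Psi_v)\times X,\qquad X=u''\Psi_u+v''\Psi_v+u'^2\Psi_{uu}+2u'v'\Psi_{uv}+v'^2\Psi_{vv}.$$ The image $\tilde\beta$ is assumed to have the corresponding representation with the same coefficients ($\tilde\nu/\tilde\kappa=\nu/\kappa$, $\tilde\eta/\tilde\kappa=\eta/\kappa$): $$\tilde\beta=\frac{\nu}{\kappa}\tilde X+\frac{\eta}{\kappa}\,(u'\tilde\Psi_u+v'\tilde\Psi_v)\times\tilde X,\qquad \tilde X=u''\tilde\Psi_u+v''\tilde\Psi_v+u'^2\tilde\Psi_{uu}+2u'v'\tilde\Psi_{uv}+v'^2\tilde\Psi_{vv}.$$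
   Formalization: The factor (av'+bu') in the last term is corrected to (av'-bu'); with N=Ψ_u×Ψ_v the printed plus sign is false, e.g. for the map from the plane z=h (h≠0) to the unit cylinder and the unit circle, with a=0, b=1. *)

theory Defs
  imports "HOL-Analysis.Analysis"
begin

unbundle cross3_syntax

definition partial_u :: "(real \<times> real \<Rightarrow> 'a::real_normed_vector) \<Rightarrow> real \<times> real \<Rightarrow> 'a" where
  "partial_u f p = vector_derivative (\<lambda>t. f (t, snd p)) (at (fst p))"

definition partial_v :: "(real \<times> real \<Rightarrow> 'a::real_normed_vector) \<Rightarrow> real \<times> real \<Rightarrow> 'a" where
  "partial_v f p = vector_derivative (\<lambda>t. f (fst p, t)) (at (snd p))"

primrec C_diff_on :: "nat \<Rightarrow> (real \<times> real) set \<Rightarrow> (real \<times> real \<Rightarrow> 'a::real_normed_vector) \<Rightarrow> bool" where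
  "C_diff_on 0 U f \<longleftrightarrow> continuous_on U f"
| "C_diff_on (Suc k) U f \<longleftrightarrow>
     f differentiable_on U \<and> C_diff_on k U (partial_u f) \<and> C_diff_on k U (partial_v f)"

definition smooth_on :: "(real \<times> real) set \<Rightarrow> (real \<times> real \<Rightarrow> 'a::real_normed_vector) \<Rightarrow> bool" where
  "smooth_on U f \<longleftrightarrow> (\<forall>k. C_diff_on k U f)"

definition smooth_real_on :: "real set \<Rightarrow> (real \<Rightarrow> real) \<Rightarrow> bool" where
  "smooth_real_on I f \<longleftrightarrow> (\<forall>k. (deriv ^^ k) f differentiable_on I)"

text \<open>The normal vector field of a patch is not normalised.\<close>

definition surface_normal :: "(real \<times> real \<Rightarrow> real^3) \<Rightarrow> real \<times> real \<Rightarrow> real^3" where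
  "surface_normal \<Psi> p = partial_u \<Psi> p \<times> partial_v \<Psi> p"

definition surface_patch :: "(real^3) set \<Rightarrow> (real \<times> real) set \<Rightarrow> (real \<times> real \<Rightarrow> real^3) \<Rightarrow> bool" where
  "surface_patch S U \<Psi> \<longleftrightarrow>
     open U \<and> smooth_on U \<Psi> \<and> (\<forall>p\<in>U. surface_normal \<Psi> p \<noteq> 0) \<and>
     openin (top_of_set S) (\<Psi> ` U) \<and> (\<exists>\<Phi>. homeomorphism U (\<Psi> ` U) \<Psi> \<Phi>)"

definition smooth_surface :: "(real^3) set \<Rightarrow> bool" where
  "smooth_surface S \<longleftrightarrow> (\<forall>x\<in>S. \<exists>U \<Psi>. surface_patch S U \<Psi> \<and> x \<in> \<Psi> ` U)"

definition coeff_E :: "(real \<times> real \<Rightarrow> real^3) \<Rightarrow> real \<times> real \<Rightarrow> real" where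
  "coeff_E \<Psi> p = partial_u \<Psi> p \<bullet> partial_u \<Psi> p"

definition coeff_F :: "(real \<times> real \<Rightarrow> real^3) \<Rightarrow> real \<times> real \<Rightarrow> real" where
  "coeff_F \<Psi> p = partial_u \<Psi> p \<bullet> partial_v \<Psi> p"

definition coeff_G :: "(real \<times> real \<Rightarrow> real^3) \<Rightarrow> real \<times> real \<Rightarrow> real" where
  "coeff_G \<Psi> p = partial_v \<Psi> p \<bullet> partial_v \<Psi> p"

text \<open>No sign condition on \<open>\<zeta>\<close> is imposed; it cannot vanish on \<open>U\<close>, since both patches
  are regular.\<close>

definition conformal_with_dilation ::
  "(real^3) set \<Rightarrow> (real^3) set \<Rightarrow> (real^3 \<Rightarrow> real^3) \<Rightarrow> (real \<times> real) set \<Rightarrow>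
   (real \<times> real \<Rightarrow> real^3) \<Rightarrow> (real \<times> real \<Rightarrow> real) \<Rightarrow> bool" where
  "conformal_with_dilation S S' J U \<Psi> \<zeta> \<longleftrightarrow>
     J ` S \<subseteq> S' \<and> surface_patch S' U (J \<circ> \<Psi>) \<and> smooth_on U \<zeta> \<and>
     (\<forall>p\<in>U. coeff_E (J \<circ> \<Psi>) p = (\<zeta> p)\<^sup>2 * coeff_E \<Psi> p \<and>
            coeff_F (J \<circ> \<Psi>) p = (\<zeta> p)\<^sup>2 * coeff_F \<Psi> p \<and>
            coeff_G (J \<circ> \<Psi>) p = (\<zeta> p)\<^sup>2 * coeff_G \<Psi> p)"

definition coeff_L :: "(real \<times> real \<Rightarrow> real^3) \<Rightarrow> real \<times> real \<Rightarrow> real" where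
  "coeff_L \<Psi> p = partial_u (partial_u \<Psi>) p \<bullet> surface_normal \<Psi> p"

definition coeff_M :: "(real \<times> real \<Rightarrow> real^3) \<Rightarrow> real \<times> real \<Rightarrow> real" where
  "coeff_M \<Psi> p = partial_v (partial_u \<Psi>) p \<bullet> surface_normal \<Psi> p"

definition coeff_N :: "(real \<times> real \<Rightarrow> real^3) \<Rightarrow> real \<times> real \<Rightarrow> real" where
  "coeff_N \<Psi> p = partial_v (partial_v \<Psi>) p \<bullet> surface_normal \<Psi> p"

definition normal_curvature ::
  "(real \<times> real \<Rightarrow> real^3) \<Rightarrow> (real \<Rightarrow> real) \<Rightarrow> (real \<Rightarrow> real) \<Rightarrow> real \<Rightarrow> real" where
  "normal_curvature \<Psi> u v s =
     (deriv u s)\<^sup>2 * coeff_L \<Psi> (u s, v s)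
     + 2 * deriv u s * deriv v s * coeff_M \<Psi> (u s, v s)
     + (deriv v s)\<^sup>2 * coeff_N \<Psi> (u s, v s)"

text \<open>By the chain rule, the next two expressions are the first and second derivative of
  \<open>\<lambda>s. \<Psi> (u s, v s)\<close>.\<close>

definition velocity_expr ::
  "(real \<times> real \<Rightarrow> real^3) \<Rightarrow> (real \<Rightarrow> real) \<Rightarrow> (real \<Rightarrow> real) \<Rightarrow> real \<Rightarrow> real^3" where
  "velocity_expr \<Psi> u v s =
     deriv u s *\<^sub>R partial_u \<Psi> (u s, v s) + deriv v s *\<^sub>R partial_v \<Psi> (u s, v s)"

definition acceleration_expr ::
  "(real \<times> real \<Rightarrow> real^3) \<Rightarrow> (real \<Rightarrow> real) \<Rightarrow> (real \<Rightarrow> real) \<Rightarrow> real \<Rightarrow> real^3" where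
  "acceleration_expr \<Psi> u v s =
     deriv (deriv u) s *\<^sub>R partial_u \<Psi> (u s, v s)
     + deriv (deriv v) s *\<^sub>R partial_v \<Psi> (u s, v s)
     + (deriv u s)\<^sup>2 *\<^sub>R partial_u (partial_u \<Psi>) (u s, v s)
     + (2 * deriv u s * deriv v s) *\<^sub>R partial_v (partial_u \<Psi>) (u s, v s)
     + (deriv v s)\<^sup>2 *\<^sub>R partial_v (partial_v \<Psi>) (u s, v s)"

definition tangent :: "(real \<Rightarrow> real^3) \<Rightarrow> real \<Rightarrow> real^3" where
  "tangent \<beta> s = vector_derivative \<beta> (at s)"

definition curvature :: "(real \<Rightarrow> real^3) \<Rightarrow> real \<Rightarrow> real" where
  "curvature \<beta> s = norm (vector_derivative (tangent \<beta>) (at s))"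

definition principal_normal :: "(real \<Rightarrow> real^3) \<Rightarrow> real \<Rightarrow> real^3" where
  "principal_normal \<beta> s = vector_derivative (tangent \<beta>) (at s) /\<^sub>R curvature \<beta> s"

definition binormal :: "(real \<Rightarrow> real^3) \<Rightarrow> real \<Rightarrow> real^3" where
  "binormal \<beta> s = tangent \<beta> s \<times> principal_normal \<beta> s"

definition normal_curve_on ::
  "real set \<Rightarrow> (real \<Rightarrow> real^3) \<Rightarrow> (real \<Rightarrow> real) \<Rightarrow> (real \<Rightarrow> real) \<Rightarrow> bool" where
  "normal_curve_on I \<beta> \<nu> \<eta> \<longleftrightarrow>
     (\<forall>s\<in>I. norm (tangent \<beta> s) = 1 \<and> curvature \<beta> s > 0) \<and>
     smooth_real_on I \<nu> \<and> smooth_real_on I \<eta> \<and>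
     (\<forall>s\<in>I. \<beta> s = \<nu> s *\<^sub>R principal_normal \<beta> s + \<eta> s *\<^sub>R binormal \<beta> s)"

text \<open>Write \<open>X\<close> for the acceleration and \<open>W\<close> for the velocity. Then
  \<open>(W \<times> X) \<bullet> \<Psi>\<^sub>u = v' \<kappa>\<^sub>n\<close> and \<open>(W \<times> X) \<bullet> \<Psi>\<^sub>v = - u' \<kappa>\<^sub>n\<close>, so that
  \<open>(W \<times> X) \<bullet> (a \<Psi>\<^sub>u + b \<Psi>\<^sub>v) = (a v' - b u') \<kappa>\<^sub>n\<close>. The formula is also found with the
  factor \<open>a v' + b u'\<close> instead, which is a sign error.\<close>

end

theory Submission
  imports Defs
begin

text \<open>The representation of \<open>\<beta>\<close> comes from the Frenet frame by the chain rule, and then has the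
  same shape as the assumed one of the image. The term \<open>W \<times> X\<close> (velocity times acceleration)
  contributes \<open>\<kappa>\<^sub>n (a v' - b u')\<close>. For the term \<open>X\<close>, the inner products of the second with the
  first partials are combinations of the first derivatives of \<open>E\<close>, \<open>F\<close>, \<open>G\<close>, as for
  Christoffel symbols of the first kind; differentiating \<open>E' = \<zeta>\<^sup>2 E\<close> etc. leaves exactly the
  terms with \<open>\<zeta> \<zeta>\<^sub>u\<close> and \<open>\<zeta> \<zeta>\<^sub>v\<close> as error.\<close>

section \<open>Partial derivatives and the chain rule\<close>

text \<open>\<open>vector_derivative\<close> is a choice operator, so \<open>partial_u\<close> is a
  true derivative only where the restriction to a coordinate line is differentiable. Total
  differentiability ensures this, by composition with the affine map from \<open>t\<close> to
  \<open>(t, snd p)\<close>.\<close>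

lemma partial_u_has_vector_derivative:
  assumes "f differentiable at p"
  shows "((\<lambda>t. f (t, snd p)) has_vector_derivative partial_u f p) (at (fst p))"
proof -
  from assms obtain D where "(f has_derivative D) (at p)"
    by (auto simp: differentiable_def)
  then have "(f has_derivative D) (at (fst p, snd p))"
    by simp
  then have "((\<lambda>t. f (t, snd p)) has_derivative (\<lambda>h. D (h, 0))) (at (fst p))"
    by (rule has_derivative_compose[rotated]) (auto intro!: derivative_eq_intros)
  then have "(\<lambda>t. f (t, snd p)) differentiable at (fst p)"
    by (auto simp: differentiable_def)
  then show ?thesis
    by (simp add: partial_u_def vector_derivative_works)
qed

lemma partial_v_has_vector_derivative:
  assumes "f differentiable at p"
  shows "((\<lambda>t. f (fst p, t)) has_vector_derivative partial_v f p) (at (snd p))"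
proof -
  from assms obtain D where "(f has_derivative D) (at p)"
    by (auto simp: differentiable_def)
  then have "(f has_derivative D) (at (fst p, snd p))"
    by simp
  then have "((\<lambda>t. f (fst p, t)) has_derivative (\<lambda>h. D (0, h))) (at (snd p))"
    by (rule has_derivative_compose[rotated]) (auto intro!: derivative_eq_intros)
  then have "(\<lambda>t. f (fst p, t)) differentiable at (snd p)"
    by (auto simp: differentiable_def)
  then show ?thesis
    by (simp add: partial_v_def vector_derivative_works)
qed

lemma partial_uI:
  "((\<lambda>t. f (t, snd p)) has_vector_derivative D) (at (fst p)) \<Longrightarrow> partial_u f p = D"
  by (simp add: partial_u_def vector_derivative_at)

lemma partial_vI:
  "((\<lambda>t. f (fst p, t)) has_vector_derivative D) (at (snd p)) \<Longrightarrow> partial_v f p = D"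
  by (simp add: partial_v_def vector_derivative_at)

text \<open>A linear map on the plane is determined by its values at \<open>(1, 0)\<close> and
  \<open>(0, 1)\<close>, and restricting to the coordinate lines identifies these values with the
  two partials.\<close>

lemma has_derivative_partials:
  assumes "f differentiable at p"
  shows "(f has_derivative (\<lambda>h. fst h *\<^sub>R partial_u f p + snd h *\<^sub>R partial_v f p)) (at p)"
proof -
  from assms obtain D where D: "(f has_derivative D) (at p)"
    by (auto simp: differentiable_def)
  then have D': "(f has_derivative D) (at (fst p, snd p))"
    by simp
  interpret D: bounded_linear D
    using D by (rule has_derivative_bounded_linear)
  have scale_u: "D (r, 0) = r *\<^sub>R D (1, 0)" for r
    using D.scaleR[of r "(1, 0)"] by simp
  have scale_v: "D (0, r) = r *\<^sub>R D (0, 1)" for r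
    using D.scaleR[of r "(0, 1)"] by simp
  have "((\<lambda>t. f (t, snd p)) has_derivative (\<lambda>h. D (h, 0))) (at (fst p))"
    using D' by (rule has_derivative_compose[rotated]) (auto intro!: derivative_eq_intros)
  then have u: "partial_u f p = D (1, 0)"
    by (intro partial_uI) (simp add: has_vector_derivative_def flip: scale_u)
  have "((\<lambda>t. f (fst p, t)) has_derivative (\<lambda>h. D (0, h))) (at (snd p))"
    using D' by (rule has_derivative_compose[rotated]) (auto intro!: derivative_eq_intros)
  then have v: "partial_v f p = D (0, 1)"
    by (intro partial_vI) (simp add: has_vector_derivative_def flip: scale_v)
  have "D h = fst h *\<^sub>R partial_u f p + snd h *\<^sub>R partial_v f p" for h
    using D.add[of "(fst h, 0)" "(0, snd h)"]
    unfolding u v scale_u[symmetric] scale_v[symmetric] by simp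
  then have "D = (\<lambda>h. fst h *\<^sub>R partial_u f p + snd h *\<^sub>R partial_v f p)"
    by (rule ext)
  from D this show ?thesis
    by (rule back_subst[of "\<lambda>D. (f has_derivative D) (at p)"])
qed

lemma has_vector_derivative_along_curve:
  assumes "f differentiable at (u s, v s)"
    and "(u has_real_derivative u') (at s)" "(v has_real_derivative v') (at s)"
  shows "((\<lambda>t. f (u t, v t)) has_vector_derivative
    u' *\<^sub>R partial_u f (u s, v s) + v' *\<^sub>R partial_v f (u s, v s)) (at s)"
proof -
  have "((\<lambda>t. (u t, v t)) has_derivative (\<lambda>h. (u' * h, v' * h))) (at s)"
    using assms(2,3)
    by (intro has_derivative_Pair) (simp_all add: has_field_derivative_def)
  from has_derivative_compose[OF this has_derivative_partials[OF assms(1)]]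
  show ?thesis
    by (simp add: has_vector_derivative_def scaleR_add_right mult.commute)
qed

text \<open>The conformality equations hold on \<open>U\<close> only. They may still be
  differentiated there, because near \<open>p\<close> both coordinate lines through \<open>p\<close>
  stay inside the open set \<open>U\<close>.\<close>

lemma partial_cong_open:
  assumes "open U" "p \<in> U" "\<And>q. q \<in> U \<Longrightarrow> f q = g q"
  shows "partial_u f p = partial_u g p" "partial_v f p = partial_v g p"
proof -
  have U: "(fst p, snd p) \<in> U"
    using assms(2) by simp
  have "((\<lambda>t. (t, snd p)) \<longlongrightarrow> (fst p, snd p)) (nhds (fst p))"
    "((\<lambda>t. (fst p, t)) \<longlongrightarrow> (fst p, snd p)) (nhds (snd p))"
    by (intro tendsto_Pair filterlim_ident tendsto_const)+
  then have "\<forall>\<^sub>F t in nhds (fst p). (t, snd p) \<in> U" "\<forall>\<^sub>F t in nhds (snd p). (fst p, t) \<in> U"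
    using assms(1) U by (auto dest: topological_tendstoD)
  then have "\<forall>\<^sub>F t in nhds (fst p). f (t, snd p) = g (t, snd p)"
    "\<forall>\<^sub>F t in nhds (snd p). f (fst p, t) = g (fst p, t)"
    by (auto elim!: eventually_mono simp: assms(3))
  then show "partial_u f p = partial_u g p" "partial_v f p = partial_v g p"
    unfolding partial_u_def partial_v_def
    by (auto intro!: vector_derivative_cong_eq)
qed

text \<open>On the reals the inner product is multiplication, so this product rule serves both for
  the coefficients E, F, G and for their multiples by the squared dilation.\<close>

lemma partial_u_inner:
  assumes "f differentiable at p" "g differentiable at p"
  shows "partial_u (\<lambda>q. f q \<bullet> g q) p = f p \<bullet> partial_u g p + partial_u f p \<bullet> g p"
  using assms[THEN partial_u_has_vector_derivative]
  by (intro partial_uI)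
    (auto simp: has_vector_derivative_def algebra_simps intro!: derivative_eq_intros)

lemma partial_v_inner:
  assumes "f differentiable at p" "g differentiable at p"
  shows "partial_v (\<lambda>q. f q \<bullet> g q) p = f p \<bullet> partial_v g p + partial_v f p \<bullet> g p"
  using assms[THEN partial_v_has_vector_derivative]
  by (intro partial_vI)
    (auto simp: has_vector_derivative_def algebra_simps intro!: derivative_eq_intros)

section \<open>Symmetry of mixed partial derivatives\<close>

text \<open>The mean value theorem is applied twice, first in the first coordinate and then in the
  second. It has no equality form for vector-valued maps, which is why everything is paired with a
  fixed \<open>e\<close>.\<close>

lemma second_difference_mean_value:
  fixes f :: "real \<times> real \<Rightarrow> 'a::real_inner"
  assumes "h > 0"
    and f: "\<And>p. p \<in> cbox (x, y) (x+h, y+h) \<Longrightarrow> f differentiable at p"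
    and fu: "\<And>p. p \<in> cbox (x, y) (x+h, y+h) \<Longrightarrow> partial_u f differentiable at p"
  obtains q where "q \<in> cbox (x, y) (x+h, y+h)"
    "(f (x+h, y+h) - f (x+h, y) - f (x, y+h) + f (x, y)) \<bullet> e
      = h * h * (partial_v (partial_u f) q \<bullet> e)"
proof -
  have inner_deriv: "((\<lambda>t. g t \<bullet> e) has_real_derivative D \<bullet> e) (at t)"
    if "(g has_vector_derivative D) (at t)" for g :: "real \<Rightarrow> 'a" and D t
    using bounded_linear.has_vector_derivative[OF bounded_linear_inner_left that, of e]
    by (simp add: has_real_derivative_iff_has_vector_derivative)
  \<comment> \<open>The second difference is the increment over \<open>[x, x+h]\<close> of the
    difference between the top and the bottom edge.\<close>
  have "((\<lambda>t. (f (t, y+h) - f (t, y)) \<bullet> e) has_real_derivative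
      (partial_u f (t, y+h) - partial_u f (t, y)) \<bullet> e) (at t)" if "x \<le> t" "t \<le> x + h" for t
    using partial_u_has_vector_derivative[OF f, of "(t, y+h)"]
      partial_u_has_vector_derivative[OF f, of "(t, y)"] that \<open>h > 0\<close>
    by (intro inner_deriv has_vector_derivative_diff) auto
  from MVT2[OF _ this, of x "x + h"] \<open>h > 0\<close> obtain \<xi> where \<xi>: "x < \<xi>" "\<xi> < x + h"
    "(f (x+h, y+h) - f (x+h, y)) \<bullet> e - (f (x, y+h) - f (x, y)) \<bullet> e =
      h * ((partial_u f (\<xi>, y+h) - partial_u f (\<xi>, y)) \<bullet> e)"
    by auto
  have "((\<lambda>t. partial_u f (\<xi>, t) \<bullet> e) has_real_derivative partial_v (partial_u f) (\<xi>, t) \<bullet> e) (at t)"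
    if "y \<le> t" "t \<le> y + h" for t
    using partial_v_has_vector_derivative[OF fu, of "(\<xi>, t)"] that \<xi>
    by (intro inner_deriv) auto
  from MVT2[OF _ this, of y "y + h"] \<open>h > 0\<close> obtain \<tau> where \<tau>: "y < \<tau>" "\<tau> < y + h"
    "partial_u f (\<xi>, y+h) \<bullet> e - partial_u f (\<xi>, y) \<bullet> e = h * (partial_v (partial_u f) (\<xi>, \<tau>) \<bullet> e)"
    by auto
  show thesis
    using \<xi> \<tau> by (intro that[of "(\<xi>, \<tau>)"]) (auto simp: inner_diff_left inner_add_left)
qed

text \<open>Exchanging the coordinates turns one mixed partial into the other, so a single mean
  value lemma covers both orders of differentiation.\<close>

lemma partial_u_swap: "partial_u (f \<circ> prod.swap) = partial_v f \<circ> prod.swap"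
  and partial_v_swap: "partial_v (f \<circ> prod.swap) = partial_u f \<circ> prod.swap"
  by (simp_all add: partial_u_def partial_v_def fun_eq_iff)

lemma differentiable_swap:
  fixes p :: "'a::real_normed_vector \<times> 'b::real_normed_vector"
  assumes "f differentiable at (prod.swap p)"
  shows "(f \<circ> prod.swap) differentiable at p"
proof -
  have "bounded_linear (prod.swap :: 'a \<times> 'b \<Rightarrow> 'b \<times> 'a)"
    unfolding prod.swap_def
    by (intro bounded_linear_Pair bounded_linear_fst bounded_linear_snd)
  then show ?thesis
    using assms by (intro differentiable_chain_at) (auto simp: bounded_linear_imp_differentiable)
qed

text \<open>Tested against any vector \<open>e\<close>, the second difference over a small square is \<open>h\<^sup>2\<close> times either
  mixed partial at some point of the square. Taking for \<open>e\<close> the difference of the two mixed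
  partials at \<open>p\<close> forces \<open>e = 0\<close>.\<close>

lemma mixed_partials_commute:
  fixes f :: "real \<times> real \<Rightarrow> 'a::real_inner"
  assumes "open U" "p \<in> U"
    and f: "\<And>q. q \<in> U \<Longrightarrow> f differentiable at q"
    and fu: "\<And>q. q \<in> U \<Longrightarrow> partial_u f differentiable at q"
    and fv: "\<And>q. q \<in> U \<Longrightarrow> partial_v f differentiable at q"
    and cont: "isCont (partial_v (partial_u f)) p" "isCont (partial_u (partial_v f)) p"
  shows "partial_u (partial_v f) p = partial_v (partial_u f) p"
proof (rule ccontr)
  assume neq: "partial_u (partial_v f) p \<noteq> partial_v (partial_u f) p"
  define e where "e = partial_u (partial_v f) p - partial_v (partial_u f) p"
  have "norm e / 2 > 0"
    using neq by (simp add: e_def)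
  \<comment> \<open>Each mixed partial is allowed an error below half of \<open>norm e\<close>, so
    that the two errors together stay strictly below \<open>norm e\<close>.\<close>
  then have "\<forall>\<^sub>F q in nhds p. dist (partial_v (partial_u f) q) (partial_v (partial_u f) p) < norm e / 2"
    "\<forall>\<^sub>F q in nhds p. dist (partial_u (partial_v f) q) (partial_u (partial_v f) p) < norm e / 2"
    using cont unfolding isCont_def tendsto_at_iff_tendsto_nhds by (blast intro: tendstoD)+
  moreover have "\<forall>\<^sub>F q in nhds p. q \<in> U"
    using assms(1,2) by (rule eventually_nhds_in_open)
  ultimately have "\<forall>\<^sub>F q in nhds p. q \<in> U \<and>
      dist (partial_v (partial_u f) q) (partial_v (partial_u f) p) < norm e / 2 \<and>
      dist (partial_u (partial_v f) q) (partial_u (partial_v f) p) < norm e / 2"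
    by eventually_elim simp
  then obtain d where "d > 0" and d: "\<And>q. dist q p < d \<Longrightarrow> q \<in> U \<and>
      dist (partial_v (partial_u f) q) (partial_v (partial_u f) p) < norm e / 2 \<and>
      dist (partial_u (partial_v f) q) (partial_u (partial_v f) p) < norm e / 2"
    unfolding eventually_nhds_metric by blast
  obtain x y where p: "p = (x, y)"
    by (cases p)
  \<comment> \<open>A point of the square is at distance at most \<open>2 * h\<close> from its
    corner \<open>p\<close>, which is less than \<open>d\<close>.\<close>
  define h where "h = d / 3"
  have "h > 0"
    using \<open>d > 0\<close> by (simp add: h_def)
  have near: "dist q p < d" if "q \<in> cbox (x, y) (x+h, y+h)" for q
  proof -
    have "dist q p \<le> \<bar>fst q - x\<bar> + \<bar>snd q - y\<bar>"
      unfolding p dist_prod_def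
      using sqrt_sum_squares_le_sum_abs[of "fst q - x" "snd q - y"] by (simp add: dist_real_def)
    also have "\<dots> < d"
      using that \<open>d > 0\<close> by (cases q) (auto simp: h_def)
    finally show ?thesis .
  qed
  obtain q where q: "q \<in> cbox (x, y) (x+h, y+h)"
    "(f (x+h, y+h) - f (x+h, y) - f (x, y+h) + f (x, y)) \<bullet> e
      = h * h * (partial_v (partial_u f) q \<bullet> e)"
    using second_difference_mean_value[OF \<open>h > 0\<close>, of x y f e] f fu d near by metis
  let ?f = "f \<circ> prod.swap"
  have swap_box: "prod.swap r \<in> cbox (x, y) (x+h, y+h)" if "r \<in> cbox (y, x) (y+h, x+h)" for r
    using that by (cases r) auto
  obtain r where r: "r \<in> cbox (y, x) (y+h, x+h)"
    "(?f (y+h, x+h) - ?f (y+h, x) - ?f (y, x+h) + ?f (y, x)) \<bullet> e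
      = h * h * (partial_v (partial_u ?f) r \<bullet> e)"
  proof (rule second_difference_mean_value[OF \<open>h > 0\<close>, of y x ?f e])
    fix r assume "r \<in> cbox (y, x) (y+h, x+h)"
    then have "prod.swap r \<in> U"
      using swap_box near d by blast
    then show "?f differentiable at r" "partial_u ?f differentiable at r"
      unfolding partial_u_swap using f fv by (blast intro: differentiable_swap)+
  qed
  \<comment> \<open>The second difference is symmetric in the two coordinates, so
    \<open>q(2)\<close> and \<open>r(2)\<close> evaluate the same number.\<close>
  have "h * h * (partial_v (partial_u f) q \<bullet> e) = h * h * (partial_u (partial_v f) (prod.swap r) \<bullet> e)"
    using q(2) r(2) by (simp add: partial_u_swap partial_v_swap algebra_simps)
  then have eq: "partial_v (partial_u f) q \<bullet> e = partial_u (partial_v f) (prod.swap r) \<bullet> e"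
    using \<open>h > 0\<close> by simp
  have "norm (partial_v (partial_u f) q - partial_v (partial_u f) p) < norm e / 2"
    using d near q(1) unfolding dist_norm by blast
  moreover have "norm (partial_u (partial_v f) (prod.swap r) - partial_u (partial_v f) p) < norm e / 2"
    using d near swap_box r(1) unfolding dist_norm by blast
  ultimately have "norm (partial_v (partial_u f) q - partial_v (partial_u f) p
      - (partial_u (partial_v f) (prod.swap r) - partial_u (partial_v f) p)) < norm e"
    by (intro le_less_trans[OF norm_triangle_ineq4]) linarith
  then have "(partial_v (partial_u f) q - partial_v (partial_u f) p
      - (partial_u (partial_v f) (prod.swap r) - partial_u (partial_v f) p)) \<bullet> e < norm e * norm e"
    using \<open>norm e / 2 > 0\<close>
    by (intro le_less_trans[OF norm_cauchy_schwarz] mult_strict_right_mono) auto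
  \<comment> \<open>By \<open>eq\<close> the values at the two intermediate points cancel against
    each other. What remains is \<open>e \<bullet> e\<close>, contradicting the strict bound just
    obtained from Cauchy-Schwarz.\<close>
  moreover have "(partial_v (partial_u f) q - partial_v (partial_u f) p
      - (partial_u (partial_v f) (prod.swap r) - partial_u (partial_v f) p)) \<bullet> e = e \<bullet> e"
    using eq by (simp add: e_def inner_diff_left)
  ultimately show False
    by (simp add: power2_norm_eq_inner flip: power2_eq_square)
qed

section \<open>Smooth maps and the first fundamental form under a conformal change\<close>

lemma smooth_on_partials:
  assumes "smooth_on U f"
  shows "smooth_on U (partial_u f)" "smooth_on U (partial_v f)"
  using assms unfolding smooth_on_def by (metis C_diff_on.simps(2))+

lemma smooth_on_differentiable:
  assumes "open U" "smooth_on U f" "p \<in> U"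
  shows "f differentiable at p"
proof -
  \<comment> \<open>Level 0 of \<open>C_diff_on\<close> is mere continuity; level 1 is the first to
    contain differentiability.\<close>
  have "C_diff_on (Suc 0) U f"
    using assms(2) unfolding smooth_on_def by blast
  then show ?thesis
    using assms(1,3) by (simp add: differentiable_on_eq_differentiable_at)
qed

lemma smooth_on_mixed_partials:
  fixes f :: "real \<times> real \<Rightarrow> 'a::real_inner"
  assumes "open U" "smooth_on U f" "p \<in> U"
  shows "partial_u (partial_v f) p = partial_v (partial_u f) p"
  using assms
  by (intro mixed_partials_commute[of U] differentiable_imp_continuous_within)
    (auto intro: smooth_on_differentiable smooth_on_partials)

text \<open>Besides the product rule this uses the symmetry of mixed partials, which leaves only six
  products of second with first partials. The six equations can then be solved for these
  products.\<close>

lemma partials_first_fundamental_form: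
  assumes "open U" "smooth_on U f" "p \<in> U"
  shows "partial_u (coeff_E f) p = 2 * (partial_u (partial_u f) p \<bullet> partial_u f p)"
    and "partial_v (coeff_E f) p = 2 * (partial_v (partial_u f) p \<bullet> partial_u f p)"
    and "partial_u (coeff_F f) p =
      partial_u (partial_u f) p \<bullet> partial_v f p + partial_v (partial_u f) p \<bullet> partial_u f p"
    and "partial_v (coeff_F f) p =
      partial_v (partial_u f) p \<bullet> partial_v f p + partial_v (partial_v f) p \<bullet> partial_u f p"
    and "partial_u (coeff_G f) p = 2 * (partial_v (partial_u f) p \<bullet> partial_v f p)"
    and "partial_v (coeff_G f) p = 2 * (partial_v (partial_v f) p \<bullet> partial_v f p)"
proof -
  have diff: "partial_u f differentiable at p" "partial_v f differentiable at p"
    using assms by (auto intro: smooth_on_differentiable smooth_on_partials)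
  have mixed: "partial_u (partial_v f) p = partial_v (partial_u f) p"
    using assms by (rule smooth_on_mixed_partials)
  have coeffs: "coeff_E f = (\<lambda>q. partial_u f q \<bullet> partial_u f q)"
    "coeff_F f = (\<lambda>q. partial_u f q \<bullet> partial_v f q)"
    "coeff_G f = (\<lambda>q. partial_v f q \<bullet> partial_v f q)"
    by (simp_all add: fun_eq_iff coeff_E_def coeff_F_def coeff_G_def)
  show "partial_u (coeff_E f) p = 2 * (partial_u (partial_u f) p \<bullet> partial_u f p)"
    "partial_v (coeff_E f) p = 2 * (partial_v (partial_u f) p \<bullet> partial_u f p)"
    "partial_u (coeff_F f) p =
      partial_u (partial_u f) p \<bullet> partial_v f p + partial_v (partial_u f) p \<bullet> partial_u f p"
    "partial_v (coeff_F f) p =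
      partial_v (partial_u f) p \<bullet> partial_v f p + partial_v (partial_v f) p \<bullet> partial_u f p"
    "partial_u (coeff_G f) p = 2 * (partial_v (partial_u f) p \<bullet> partial_v f p)"
    "partial_v (coeff_G f) p = 2 * (partial_v (partial_v f) p \<bullet> partial_v f p)"
    unfolding coeffs by (simp_all add: partial_u_inner partial_v_inner diff mixed inner_commute)
qed

lemma partials_square_times:
  fixes z g :: "real \<times> real \<Rightarrow> real"
  assumes "open U" "p \<in> U" "z differentiable at p" "g differentiable at p"
    and eq: "\<And>q. q \<in> U \<Longrightarrow> f q = (z q)\<^sup>2 * g q"
  shows "partial_u f p = (z p)\<^sup>2 * partial_u g p + 2 * z p * partial_u z p * g p"
    and "partial_v f p = (z p)\<^sup>2 * partial_v g p + 2 * z p * partial_v z p * g p"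
proof -
  \<comment> \<open>Written as nested inner products, the square and the outer product both fall
    under the product rule for \<open>\<bullet>\<close>.\<close>
  have f: "partial_u f p = partial_u (\<lambda>q. (z q \<bullet> z q) \<bullet> g q) p"
    "partial_v f p = partial_v (\<lambda>q. (z q \<bullet> z q) \<bullet> g q) p"
    using eq by (auto intro!: partial_cong_open[OF assms(1,2)] simp: power2_eq_square)
  have zz: "(\<lambda>q. z q \<bullet> z q) differentiable at p"
    using assms(3) by simp
  show "partial_u f p = (z p)\<^sup>2 * partial_u g p + 2 * z p * partial_u z p * g p"
    "partial_v f p = (z p)\<^sup>2 * partial_v g p + 2 * z p * partial_v z p * g p"
    unfolding f partial_u_inner[OF zz assms(4)] partial_u_inner[OF assms(3,3)]
      partial_v_inner[OF zz assms(4)] partial_v_inner[OF assms(3,3)]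
    by (simp_all add: power2_eq_square algebra_simps)
qed

text \<open>Four of the products are half a derivative of E or G. The other two are
  \<open>F\<^sub>u - E\<^sub>v / 2\<close> (for uu against v) and
  \<open>F\<^sub>v - G\<^sub>u / 2\<close> (for vv against u), which explains their two error terms:
  a doubled one with F and a subtracted one with E or G.\<close>

lemma inner_second_partials_conformal:
  fixes f g :: "real \<times> real \<Rightarrow> real^3" and z :: "real \<times> real \<Rightarrow> real"
  assumes "open U" "p \<in> U" "smooth_on U f" "smooth_on U g" "smooth_on U z"
    and EFG: "\<forall>q\<in>U. coeff_E g q = (z q)\<^sup>2 * coeff_E f q"
      "\<forall>q\<in>U. coeff_F g q = (z q)\<^sup>2 * coeff_F f q"
      "\<forall>q\<in>U. coeff_G g q = (z q)\<^sup>2 * coeff_G f q"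
  shows "partial_u (partial_u g) p \<bullet> partial_u g p =
      (z p)\<^sup>2 * (partial_u (partial_u f) p \<bullet> partial_u f p) + z p * partial_u z p * coeff_E f p"
    and "partial_v (partial_u g) p \<bullet> partial_u g p =
      (z p)\<^sup>2 * (partial_v (partial_u f) p \<bullet> partial_u f p) + z p * partial_v z p * coeff_E f p"
    and "partial_v (partial_v g) p \<bullet> partial_u g p =
      (z p)\<^sup>2 * (partial_v (partial_v f) p \<bullet> partial_u f p)
      + 2 * z p * partial_v z p * coeff_F f p - z p * partial_u z p * coeff_G f p"
    and "partial_u (partial_u g) p \<bullet> partial_v g p =
      (z p)\<^sup>2 * (partial_u (partial_u f) p \<bullet> partial_v f p)
      + 2 * z p * partial_u z p * coeff_F f p - z p * partial_v z p * coeff_E f p"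
    and "partial_v (partial_u g) p \<bullet> partial_v g p =
      (z p)\<^sup>2 * (partial_v (partial_u f) p \<bullet> partial_v f p) + z p * partial_u z p * coeff_G f p"
    and "partial_v (partial_v g) p \<bullet> partial_v g p =
      (z p)\<^sup>2 * (partial_v (partial_v f) p \<bullet> partial_v f p) + z p * partial_v z p * coeff_G f p"
proof -
  have z: "z differentiable at p"
    using assms by (auto intro: smooth_on_differentiable)
  have "partial_u f differentiable at p" "partial_v f differentiable at p"
    using assms by (auto intro: smooth_on_differentiable smooth_on_partials)
  then have EFG_diff: "coeff_E f differentiable at p" "coeff_F f differentiable at p"
    "coeff_G f differentiable at p"
    unfolding coeff_E_def[abs_def] coeff_F_def[abs_def] coeff_G_def[abs_def] by simp_all
  note partials =
    partials_square_times[OF assms(1,2) z EFG_diff(1) EFG(1)[rule_format]]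
    partials_square_times[OF assms(1,2) z EFG_diff(2) EFG(2)[rule_format]]
    partials_square_times[OF assms(1,2) z EFG_diff(3) EFG(3)[rule_format]]
  note f = partials_first_fundamental_form[OF assms(1,3,2)]
  note g = partials_first_fundamental_form[OF assms(1,4,2)]
  show "partial_u (partial_u g) p \<bullet> partial_u g p =
      (z p)\<^sup>2 * (partial_u (partial_u f) p \<bullet> partial_u f p) + z p * partial_u z p * coeff_E f p"
    "partial_v (partial_u g) p \<bullet> partial_u g p =
      (z p)\<^sup>2 * (partial_v (partial_u f) p \<bullet> partial_u f p) + z p * partial_v z p * coeff_E f p"
    "partial_v (partial_v g) p \<bullet> partial_u g p =
      (z p)\<^sup>2 * (partial_v (partial_v f) p \<bullet> partial_u f p)
      + 2 * z p * partial_v z p * coeff_F f p - z p * partial_u z p * coeff_G f p"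
    "partial_u (partial_u g) p \<bullet> partial_v g p =
      (z p)\<^sup>2 * (partial_u (partial_u f) p \<bullet> partial_v f p)
      + 2 * z p * partial_u z p * coeff_F f p - z p * partial_v z p * coeff_E f p"
    "partial_v (partial_u g) p \<bullet> partial_v g p =
      (z p)\<^sup>2 * (partial_v (partial_u f) p \<bullet> partial_v f p) + z p * partial_u z p * coeff_G f p"
    "partial_v (partial_v g) p \<bullet> partial_v g p =
      (z p)\<^sup>2 * (partial_v (partial_v f) p \<bullet> partial_v f p) + z p * partial_v z p * coeff_G f p"
    \<comment> \<open>Once the derivatives of the coefficients are expanded for both patches,
      \<open>partials\<close> is a linear system for the six products.\<close>
    using partials unfolding f g by (simp_all add: algebra_simps)
qed

section \<open>Velocity, acceleration and normal curvature of curves on a patch\<close>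

text \<open>Cyclic symmetry of the triple product moves the cross product onto the two tangent
  vectors. Their cross product is a multiple of the surface normal, and the minus sign in the factor
  comes from its antisymmetry.\<close>

lemma velocity_cross_acceleration_inner:
  "(velocity_expr \<Psi> u v s \<times> acceleration_expr \<Psi> u v s) \<bullet>
      (a *\<^sub>R partial_u \<Psi> (u s, v s) + b *\<^sub>R partial_v \<Psi> (u s, v s)) =
    normal_curvature \<Psi> u v s * (a * deriv v s - b * deriv u s)"
proof -
  have *: "((x *\<^sub>R P + y *\<^sub>R Q) \<times> X) \<bullet> (a *\<^sub>R P + b *\<^sub>R Q) = (X \<bullet> (P \<times> Q)) * (a * y - b * x)"
    for x y and P Q X :: "real^3"
    by (simp add: cross3_simps)
  \<comment> \<open>The terms with \<open>u''\<close> and \<open>v''\<close> are tangential and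
    vanish against the normal.\<close>
  have "acceleration_expr \<Psi> u v s \<bullet> (partial_u \<Psi> (u s, v s) \<times> partial_v \<Psi> (u s, v s)) =
      normal_curvature \<Psi> u v s"
    by (simp add: acceleration_expr_def normal_curvature_def coeff_L_def coeff_M_def coeff_N_def
        surface_normal_def inner_add_left dot_cross_self)
  then show ?thesis
    unfolding velocity_expr_def * by simp
qed

lemma smooth_real_on_has_derivative:
  assumes "open I" "smooth_real_on I w" "t \<in> I"
  shows "(w has_real_derivative deriv w t) (at t)"
    and "(deriv w has_real_derivative deriv (deriv w) t) (at t)"
proof -
  have "(deriv ^^ k) w differentiable at t" for k
    using assms by (auto simp: smooth_real_on_def differentiable_on_eq_differentiable_at)
  from this[of 0] this[of 1] show "(w has_real_derivative deriv w t) (at t)"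
    "(deriv w has_real_derivative deriv (deriv w) t) (at t)"
    by (auto simp: DERIV_deriv_iff_real_differentiable)
qed

lemma curve_derivatives:
  assumes "open U" "smooth_on U \<Psi>" "open I" "smooth_real_on I u" "smooth_real_on I v"
    and U: "\<And>t. t \<in> I \<Longrightarrow> (u t, v t) \<in> U" and \<beta>: "\<And>t. t \<in> I \<Longrightarrow> \<beta> t = \<Psi> (u t, v t)"
    and "s \<in> I"
  shows "tangent \<beta> s = velocity_expr \<Psi> u v s"
    and "vector_derivative (tangent \<beta>) (at s) = acceleration_expr \<Psi> u v s"
proof -
  note uv = smooth_real_on_has_derivative[OF \<open>open I\<close> \<open>smooth_real_on I u\<close>]
    smooth_real_on_has_derivative[OF \<open>open I\<close> \<open>smooth_real_on I v\<close>]
  note smooth = \<open>smooth_on U \<Psi>\<close> smooth_on_partials[OF \<open>smooth_on U \<Psi>\<close>]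
  have chain: "((\<lambda>t. f (u t, v t)) has_vector_derivative
      deriv u t *\<^sub>R partial_u f (u t, v t) + deriv v t *\<^sub>R partial_v f (u t, v t)) (at t)"
    if "smooth_on U f" "t \<in> I" for f :: "real \<times> real \<Rightarrow> real^3" and t
    using that uv U \<open>open U\<close>
    by (intro has_vector_derivative_along_curve) (auto intro: smooth_on_differentiable)
  \<comment> \<open>The formula is proved on all of \<open>I\<close>: differentiating
    \<open>tangent \<beta>\<close> at \<open>s\<close> requires it in a neighbourhood of
    \<open>s\<close>.\<close>
  have tangent: "tangent \<beta> t = velocity_expr \<Psi> u v t" if "t \<in> I" for t
  proof -
    have "(\<beta> has_vector_derivative velocity_expr \<Psi> u v t) (at t)"
      using has_vector_derivative_transform_within_open[OF chain[OF smooth(1) that] \<open>open I\<close> that] \<beta>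
      by (simp add: velocity_expr_def)
    then show ?thesis
      by (simp add: tangent_def vector_derivative_at)
  qed
  show "tangent \<beta> s = velocity_expr \<Psi> u v s"
    using \<open>s \<in> I\<close> by (rule tangent)
  \<comment> \<open>The chain rule produces each mixed partial once; their equality gives the factor
    2 in the acceleration.\<close>
  have mixed: "partial_u (partial_v \<Psi>) (u s, v s) = partial_v (partial_u \<Psi>) (u s, v s)"
    using assms by (intro smooth_on_mixed_partials[of U]) auto
  have "(velocity_expr \<Psi> u v has_vector_derivative acceleration_expr \<Psi> u v s) (at s)"
    unfolding velocity_expr_def[abs_def]
  proof (rule has_vector_derivative_eq_rhs)
    show "((\<lambda>t. deriv u t *\<^sub>R partial_u \<Psi> (u t, v t) + deriv v t *\<^sub>R partial_v \<Psi> (u t, v t))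
      has_vector_derivative
        deriv u s *\<^sub>R (deriv u s *\<^sub>R partial_u (partial_u \<Psi>) (u s, v s)
          + deriv v s *\<^sub>R partial_v (partial_u \<Psi>) (u s, v s))
        + deriv (deriv u) s *\<^sub>R partial_u \<Psi> (u s, v s)
        + (deriv v s *\<^sub>R (deriv u s *\<^sub>R partial_u (partial_v \<Psi>) (u s, v s)
          + deriv v s *\<^sub>R partial_v (partial_v \<Psi>) (u s, v s))
        + deriv (deriv v) s *\<^sub>R partial_v \<Psi> (u s, v s))) (at s)"
      using \<open>s \<in> I\<close> by (intro has_vector_derivative_add has_vector_derivative_scaleR uv chain smooth)
  qed (simp only: acceleration_expr_def mixed power2_eq_square mult_2 mult_2_right distrib_left distrib_right
      scaleR_add_left scaleR_add_right scaleR_scaleR ac_simps)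
  then have "(tangent \<beta> has_vector_derivative acceleration_expr \<Psi> u v s) (at s)"
    by (rule has_vector_derivative_transform_within_open[OF _ \<open>open I\<close> \<open>s \<in> I\<close>]) (simp add: tangent)
  then show "vector_derivative (tangent \<beta>) (at s) = acceleration_expr \<Psi> u v s"
    by (rule vector_derivative_at)
qed

section \<open>The tangential component of the conformal image\<close>

theorem theorem3p8:
  fixes S S' :: "(real^3) set" and J :: "real^3 \<Rightarrow> real^3"
    and U :: "(real \<times> real) set" and \<Psi> \<Psi>' :: "real \<times> real \<Rightarrow> real^3" and \<zeta> :: "real \<times> real \<Rightarrow> real"
    and I :: "real set" and u v \<nu> \<eta> :: "real \<Rightarrow> real" and \<beta> \<beta>' :: "real \<Rightarrow> real^3"
    and a b s g\<^sub>1 g\<^sub>2 :: real and T T' :: "real^3"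
  assumes surfaces: "smooth_surface S" "smooth_surface S'"
    and patch: "surface_patch S U \<Psi>"
    and conformal: "conformal_with_dilation S S' J U \<Psi> \<zeta>"
    and image_patch: "\<Psi>' = J \<circ> \<Psi>"
    and interval: "open I" "is_interval I"
    and uv: "smooth_real_on I u" "smooth_real_on I v" "\<forall>t\<in>I. (u t, v t) \<in> U"
    and curve: "\<forall>t\<in>I. \<beta> t = \<Psi> (u t, v t)"
    and normal: "normal_curve_on I \<beta> \<nu> \<eta>"
    and image_curve: "\<forall>t\<in>I. \<beta>' t = J (\<beta> t)"
    and image_repr: "\<forall>t\<in>I. \<beta>' t =
      (\<nu> t / curvature \<beta> t) *\<^sub>R acceleration_expr \<Psi>' u v t
      + (\<eta> t / curvature \<beta> t) *\<^sub>R (velocity_expr \<Psi>' u v t \<times> acceleration_expr \<Psi>' u v t)"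
    and s: "s \<in> I"
    and T: "T = a *\<^sub>R partial_u \<Psi> (u s, v s) + b *\<^sub>R partial_v \<Psi> (u s, v s)"
    and T': "T' = a *\<^sub>R partial_u \<Psi>' (u s, v s) + b *\<^sub>R partial_v \<Psi>' (u s, v s)"
    and g\<^sub>1: "g\<^sub>1 = (\<nu> s / curvature \<beta> s) *
      ((deriv u s)\<^sup>2 * \<zeta> (u s, v s) * partial_u \<zeta> (u s, v s) * coeff_E \<Psi> (u s, v s)
       + 2 * deriv u s * deriv v s * \<zeta> (u s, v s) * partial_v \<zeta> (u s, v s) * coeff_E \<Psi> (u s, v s)
       + (deriv v s)\<^sup>2 * (2 * \<zeta> (u s, v s) * partial_v \<zeta> (u s, v s) * coeff_F \<Psi> (u s, v s)
                        - \<zeta> (u s, v s) * partial_u \<zeta> (u s, v s) * coeff_G \<Psi> (u s, v s)))"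
    and g\<^sub>2: "g\<^sub>2 = (\<nu> s / curvature \<beta> s) *
      ((deriv u s)\<^sup>2 * (2 * \<zeta> (u s, v s) * partial_u \<zeta> (u s, v s) * coeff_F \<Psi> (u s, v s)
                        - \<zeta> (u s, v s) * partial_v \<zeta> (u s, v s) * coeff_E \<Psi> (u s, v s))
       + 2 * deriv u s * deriv v s * \<zeta> (u s, v s) * partial_u \<zeta> (u s, v s) * coeff_G \<Psi> (u s, v s)
       + (deriv v s)\<^sup>2 * \<zeta> (u s, v s) * partial_v \<zeta> (u s, v s) * coeff_G \<Psi> (u s, v s))"
  shows "\<beta>' s \<bullet> T' - (\<zeta> (u s, v s))\<^sup>2 * (\<beta> s \<bullet> T) =
    (a * g\<^sub>1 + b * g\<^sub>2)
    + (\<eta> s / curvature \<beta> s)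
      * (normal_curvature \<Psi>' u v s - (\<zeta> (u s, v s))\<^sup>2 * normal_curvature \<Psi> u v s)
      * (a * deriv v s - b * deriv u s)"
proof -
  let ?p = "(u s, v s)"
  let ?\<kappa> = "curvature \<beta> s"
  have "open U" "smooth_on U \<Psi>"
    using patch by (auto simp: surface_patch_def)
  have smooth: "smooth_on U \<Psi>'" "smooth_on U \<zeta>"
    and EFG: "\<forall>q\<in>U. coeff_E \<Psi>' q = (\<zeta> q)\<^sup>2 * coeff_E \<Psi> q"
      "\<forall>q\<in>U. coeff_F \<Psi>' q = (\<zeta> q)\<^sup>2 * coeff_F \<Psi> q"
      "\<forall>q\<in>U. coeff_G \<Psi>' q = (\<zeta> q)\<^sup>2 * coeff_G \<Psi> q"
    using conformal by (auto simp: image_patch conformal_with_dilation_def surface_patch_def)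
  have "?p \<in> U"
    using uv(3) s by blast
  have tangent: "tangent \<beta> s = velocity_expr \<Psi> u v s"
    and acceleration: "vector_derivative (tangent \<beta>) (at s) = acceleration_expr \<Psi> u v s"
    using curve_derivatives[OF \<open>open U\<close> \<open>smooth_on U \<Psi>\<close> interval(1) uv(1,2), of \<beta> s] uv(3) curve s
    by auto
  \<comment> \<open>The principal normal is the acceleration divided by the curvature, and the
    binormal is the velocity crossed with it; both divisions move into the coefficients.\<close>
  have repr: "\<beta> s = (\<nu> s / ?\<kappa>) *\<^sub>R acceleration_expr \<Psi> u v s
      + (\<eta> s / ?\<kappa>) *\<^sub>R (velocity_expr \<Psi> u v s \<times> acceleration_expr \<Psi> u v s)"
    using normal s
    by (simp add: normal_curve_on_def binormal_def principal_normal_def acceleration tangent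
        cross_mult_right divide_inverse)
  have repr': "\<beta>' s = (\<nu> s / ?\<kappa>) *\<^sub>R acceleration_expr \<Psi>' u v s
      + (\<eta> s / ?\<kappa>) *\<^sub>R (velocity_expr \<Psi>' u v s \<times> acceleration_expr \<Psi>' u v s)"
    using image_repr s by blast
  have \<beta>T: "\<beta> s \<bullet> T = (\<nu> s / ?\<kappa>) * (acceleration_expr \<Psi> u v s \<bullet> T)
      + (\<eta> s / ?\<kappa>) * (normal_curvature \<Psi> u v s * (a * deriv v s - b * deriv u s))"
    by (simp only: repr T inner_add_left inner_scaleR_left velocity_cross_acceleration_inner)
  have \<beta>T': "\<beta>' s \<bullet> T' = (\<nu> s / ?\<kappa>) * (acceleration_expr \<Psi>' u v s \<bullet> T')
      + (\<eta> s / ?\<kappa>) * (normal_curvature \<Psi>' u v s * (a * deriv v s - b * deriv u s))"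
    by (simp only: repr' T' inner_add_left inner_scaleR_left velocity_cross_acceleration_inner)
  \<comment> \<open>These equations treat the terms with \<open>u''\<close> and \<open>v''\<close>,
    which scale exactly by the squared dilation. The mixed product is listed in both orders so that
    either one can be rewritten.\<close>
  have EFG_p: "partial_u \<Psi>' ?p \<bullet> partial_u \<Psi>' ?p = (\<zeta> ?p)\<^sup>2 * (partial_u \<Psi> ?p \<bullet> partial_u \<Psi> ?p)"
    "partial_u \<Psi>' ?p \<bullet> partial_v \<Psi>' ?p = (\<zeta> ?p)\<^sup>2 * (partial_u \<Psi> ?p \<bullet> partial_v \<Psi> ?p)"
    "partial_v \<Psi>' ?p \<bullet> partial_u \<Psi>' ?p = (\<zeta> ?p)\<^sup>2 * (partial_v \<Psi> ?p \<bullet> partial_u \<Psi> ?p)"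
    "partial_v \<Psi>' ?p \<bullet> partial_v \<Psi>' ?p = (\<zeta> ?p)\<^sup>2 * (partial_v \<Psi> ?p \<bullet> partial_v \<Psi> ?p)"
    using EFG \<open>?p \<in> U\<close> by (simp_all add: coeff_E_def coeff_F_def coeff_G_def inner_commute)
  note conformal_p = inner_second_partials_conformal[OF
      \<open>open U\<close> \<open>?p \<in> U\<close> \<open>smooth_on U \<Psi>\<close> smooth EFG]
  \<comment> \<open>Only the terms with second partials leave an error, and together these are the
    bracket of \<open>g\<^sub>1\<close>. The common factor \<open>\<nu> s / ?\<kappa>\<close> is
    pulled out first, so that just the brackets are compared.\<close>
  have tangential_u: "(\<nu> s / ?\<kappa>) * (acceleration_expr \<Psi>' u v s \<bullet> partial_u \<Psi>' ?p)
      = (\<nu> s / ?\<kappa>) * ((\<zeta> ?p)\<^sup>2 * (acceleration_expr \<Psi> u v s \<bullet> partial_u \<Psi> ?p)) + g\<^sub>1"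
    unfolding acceleration_expr_def g\<^sub>1 inner_add_left inner_scaleR_left EFG_p conformal_p
      distrib_left[symmetric]
    by (rule arg_cong[of _ _ "(*) (\<nu> s / ?\<kappa>)"]) (simp add: algebra_simps)
  have tangential_v: "(\<nu> s / ?\<kappa>) * (acceleration_expr \<Psi>' u v s \<bullet> partial_v \<Psi>' ?p)
      = (\<nu> s / ?\<kappa>) * ((\<zeta> ?p)\<^sup>2 * (acceleration_expr \<Psi> u v s \<bullet> partial_v \<Psi> ?p)) + g\<^sub>2"
    unfolding acceleration_expr_def g\<^sub>2 inner_add_left inner_scaleR_left EFG_p conformal_p
      distrib_left[symmetric]
    by (rule arg_cong[of _ _ "(*) (\<nu> s / ?\<kappa>)"]) (simp add: algebra_simps)
  \<comment> \<open>\<open>T\<close> and \<open>T'\<close> have the same coefficients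
    \<open>a\<close> and \<open>b\<close>, so linearity combines the two errors into
    \<open>a * g\<^sub>1 + b * g\<^sub>2\<close>.\<close>
  have "(\<nu> s / ?\<kappa>) * (acceleration_expr \<Psi>' u v s \<bullet> T')
      = a * ((\<nu> s / ?\<kappa>) * (acceleration_expr \<Psi>' u v s \<bullet> partial_u \<Psi>' ?p))
        + b * ((\<nu> s / ?\<kappa>) * (acceleration_expr \<Psi>' u v s \<bullet> partial_v \<Psi>' ?p))"
    by (simp add: T' inner_add_right distrib_left mult.left_commute)
  also have "\<dots> = (\<nu> s / ?\<kappa>) * ((\<zeta> ?p)\<^sup>2 * (acceleration_expr \<Psi> u v s \<bullet> T)) + (a * g\<^sub>1 + b * g\<^sub>2)"
    unfolding tangential_u tangential_v by (simp add: T inner_add_right algebra_simps)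
  finally have "(\<nu> s / ?\<kappa>) * (acceleration_expr \<Psi>' u v s \<bullet> T')
      = (\<nu> s / ?\<kappa>) * ((\<zeta> ?p)\<^sup>2 * (acceleration_expr \<Psi> u v s \<bullet> T)) + (a * g\<^sub>1 + b * g\<^sub>2)" .
  then show ?thesis
    unfolding \<beta>T \<beta>T' by (simp add: algebra_simps add_divide_distrib diff_divide_distrib)
qed

end
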